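(* Let $0\le c<d$ and let $g:[c,d]\to\mathbb{R}$ be continuous, piecewise strictly monotone and differentiable on $[c,d]$. Let $\Gamma=\{(g(y),y) : y\in[c,d]\}$ be the curve $x=g(y)$, and put $a=\min(g(c),g(d))$, $b=\max(g(c),g(d))$. Suppose that $a<b$ and that each of the lines $x=a$ and $x=b$ intersects the curve $x=g(y)$, $y\in[c,d]$, in exactly one point. Then the volume $V_X$ of the solid obtained by rotating about the $x$-axis the plane region bounded by $y=0$, $x=a$, $\Gamma$ and $x=b$ is $$V_X=\operatorname{sgn}(g(d)-g(c))\left\{\pi\left[d^2g(d)-c^2g(c)\right]-2\pi\int_c^d y\, g(y)\,dy\right\}.$$
   Context: $\operatorname{sgn}$ denotes the sign function: $\operatorname{sgn}(t)=1$ for $t>0$, $\operatorname{sgn}(0)=0$, $\operatorname{sgn}(t)=-1$ for $t<0$. A function is piecewise strictly monotone on $[c,d]$ if $[c,d]$ can be divided into finitely many closed subintervals, consecutive ones sharing only an endpoint, on each of which the function is strictly monotone. The plane region bounded by $y=0$, $x=a$, $\Gamma$ and $x=b$ is the bounded region enclosed by the closed curve consisting of the segment of the $x$-axis from $(a,0)$ to $(b,0)$, the vertical segment from $(g(c),0)$ to $(g(c),c)$ (a single point if $c=0$), the curve $\Gamma$, and the vertical segment from $(g(d),0)$ to $(g(d),d)$. *)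

theory Defs
  imports "HOL-Analysis.Analysis"
begin

definition piecewise_strictly_monotone :: "(real \<Rightarrow> real) \<Rightarrow> real \<Rightarrow> real \<Rightarrow> bool" where
  "piecewise_strictly_monotone f c d \<longleftrightarrow>
     (\<exists>(n::nat) (t :: nat \<Rightarrow> real). t 0 = c \<and> t n = d \<and>
        (\<forall>i<n. t i < t (Suc i) \<and>
           (strict_mono_on {t i..t (Suc i)} f \<or> strict_antimono_on {t i..t (Suc i)} f)))"

text \<open>The curve $x = g(y)$; the parameter is the second coordinate.\<close>

definition curve_x_of_y :: "(real \<Rightarrow> real) \<Rightarrow> real \<Rightarrow> real \<Rightarrow> (real \<times> real) set" where
  "curve_x_of_y g c d = (\<lambda>y. (g y, y)) ` {c..d}"

definition boundary_curve :: "(real \<Rightarrow> real) \<Rightarrow> real \<Rightarrow> real \<Rightarrow> (real \<times> real) set" where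
  "boundary_curve g c d =
     closed_segment (min (g c) (g d), 0) (max (g c) (g d), 0) \<union>
     closed_segment (g c, 0) (g c, c) \<union>
     curve_x_of_y g c d \<union>
     closed_segment (g d, 0) (g d, d)"

text \<open>The bounded region enclosed by the boundary curve, taken as a closed region: \<open>inside S\<close> is
  the union of the bounded components of the complement of \<open>S\<close>, and the curve itself is added.\<close>

definition bounded_region :: "(real \<Rightarrow> real) \<Rightarrow> real \<Rightarrow> real \<Rightarrow> (real \<times> real) set" where
  "bounded_region g c d = boundary_curve g c d \<union> inside (boundary_curve g c d)"

text \<open>The plane is embedded in space as $z = 0$; a point $(x,y,0)$ is rotated about the
  $x$-axis through every angle.\<close>

definition rotate_about_x_axis :: "(real \<times> real) set \<Rightarrow> (real \<times> real \<times> real) set" where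
  "rotate_about_x_axis R = {(x, y * cos \<theta>, y * sin \<theta>) | x y \<theta>. (x, y) \<in> R}"

end

theory Submission
  imports Defs
begin

text \<open>The curve is a graph over the vertical axis. Extend \<open>g\<close> to \<open>[0, d]\<close> by the
  constant \<open>g c\<close> on \<open>[0, c]\<close> and call the result \<open>h\<close>: its graph is the vertical segment at \<open>g c\<close> followed by \<open>\<Gamma>\<close>. The boundary
  curve then consists of the graph of \<open>h\<close>, the vertical segment at \<open>g d\<close>, and a piece of the
  \<open>x\<close>-axis, so the enclosed region has as its slice at each height \<open>y\<close> in \<open>[0, d]\<close> the interval
  between \<open>h y\<close> and \<open>g d\<close> (\<open>bounded_region_eq\<close>). Taking the minimum and the maximum of \<open>h y\<close> and \<open>g d\<close>
  as ends of that interval treats \<open>g c < g d\<close> and \<open>g d < g c\<close> at once.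

  The points inside the boundary curve are found directly (\<open>inside_band_boundary\<close>): a connected set
  cannot leave the open band without crossing its frontier, which lies on the boundary curve;
  and a point off the closed band can escape to infinity along a horizontal ray.

  The volume is computed by cylindrical shells (\<open>volume_rotated_band\<close>): a line parallel to the
  \<open>x\<close>-axis at distance \<open>y \<le> d\<close> from it meets the solid in a segment of length \<open>\<bar>g d - h y\<bar>\<close>,
  so by Fubini and polar coordinates in the \<open>(y, z)\<close>-plane the volume is
  \<open>\<integral>\<^sub>0\<^sup>d 2 \<pi> y \<bar>g d - h y\<bar> dy\<close>. Since \<open>\<Gamma>\<close> meets the line \<open>x = g d\<close>
  only at its end point, the intermediate value theorem gives \<open>g d - h y\<close> the sign of
  \<open>g d - g c\<close> for every \<open>y < d\<close>; that sign factors out, and splitting the integral at \<open>c\<close>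
  gives the formula.\<close>

section \<open>Planar regions between two graphs over the vertical axis\<close>

definition closed_band :: "(real \<Rightarrow> real) \<Rightarrow> (real \<Rightarrow> real) \<Rightarrow> real \<Rightarrow> (real \<times> real) set" where
  "closed_band l r d = {(x, y). 0 \<le> y \<and> y \<le> d \<and> l y \<le> x \<and> x \<le> r y}"

definition open_band :: "(real \<Rightarrow> real) \<Rightarrow> (real \<Rightarrow> real) \<Rightarrow> real \<Rightarrow> (real \<times> real) set" where
  "open_band l r d = {(x, y). 0 < y \<and> y < d \<and> l y < x \<and> x < r y}"

lemma open_band_subset: "open_band l r d \<subseteq> closed_band l r d"
  by (auto simp: open_band_def closed_band_def)

lemma open_open_band:
  assumes "continuous_on UNIV l" "continuous_on UNIV r"
  shows "open (open_band l r d)"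
proof -
  have *: "continuous_on UNIV (\<lambda>p::real \<times> real. l (snd p))" "continuous_on UNIV (\<lambda>p::real \<times> real. r (snd p))"
    by (auto intro!: continuous_on_compose2[OF assms(1)] continuous_on_compose2[OF assms(2)]
        continuous_intros)
  have "open_band l r d = {p. 0 < snd p} \<inter> {p. snd p < d} \<inter> {p. l (snd p) < fst p} \<inter> {p. fst p < r (snd p)}"
    by (auto simp: open_band_def)
  then show ?thesis
    using * by (auto intro!: open_Int open_Collect_less continuous_intros)
qed

lemma compact_closed_band:
  assumes "continuous_on UNIV l" "continuous_on UNIV r"
  shows "compact (closed_band l r d)"
proof -
  have *: "continuous_on UNIV (\<lambda>p::real \<times> real. l (snd p))" "continuous_on UNIV (\<lambda>p::real \<times> real. r (snd p))"
    by (auto intro!: continuous_on_compose2[OF assms(1)] continuous_on_compose2[OF assms(2)]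
        continuous_intros)
  have "closed_band l r d = {p. 0 \<le> snd p} \<inter> {p. snd p \<le> d} \<inter> {p. l (snd p) \<le> fst p} \<inter> {p. fst p \<le> r (snd p)}"
    by (auto simp: closed_band_def)
  then have "closed (closed_band l r d)"
    using * by (auto intro!: closed_Int closed_Collect_le continuous_intros)
  moreover have "bounded (closed_band l r d)"
  proof -
    have "compact (l ` {0..d})" "compact (r ` {0..d})"
      using assms by (auto intro!: compact_continuous_image intro: continuous_on_subset)
    then obtain A B where "\<And>y. y \<in> {0..d} \<Longrightarrow> \<bar>l y\<bar> \<le> A" "\<And>y. y \<in> {0..d} \<Longrightarrow> \<bar>r y\<bar> \<le> B"
      by (force dest!: compact_imp_bounded simp: bounded_iff)
    then have "closed_band l r d \<subseteq> {-A..B} \<times> {0..d}"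
      by (force simp: closed_band_def abs_le_iff)
    then show ?thesis
      by (rule bounded_subset[rotated]) (auto intro: bounded_Times)
  qed
  ultimately show ?thesis
    by (simp add: compact_eq_bounded_closed)
qed

lemma outside_if_unbounded_connected:
  fixes S :: "'a::real_normed_vector set"
  assumes "connected T" "p \<in> T" "T \<inter> S = {}" "\<not> bounded T"
  shows "p \<in> outside S"
proof -
  have "T \<subseteq> connected_component_set (- S) p"
    using assms by (intro connected_component_maximal) auto
  then show ?thesis
    using assms bounded_subset by (auto simp: outside)
qed

lemma not_bounded_horizontal_ray:
  fixes y s :: real
  assumes "\<bar>s\<bar> = 1"
  shows "\<not> bounded ((\<lambda>t. (x + s * t, y)) ` {0::real..})"
proof
  assume "bounded ((\<lambda>t. (x + s * t, y)) ` {0::real..})"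
  then have "bounded (fst ` (\<lambda>t. (x + s * t, y)) ` {0::real..})"
    by (rule bounded_fst)
  then obtain B where B: "\<And>t. 0 \<le> t \<Longrightarrow> \<bar>x + s * t\<bar> \<le> B"
    by (auto simp: bounded_iff)
  have "\<bar>s * (\<bar>B\<bar> + \<bar>x\<bar> + 1)\<bar> = \<bar>B\<bar> + \<bar>x\<bar> + 1"
    using assms by (simp add: abs_mult)
  then show False
    using B[of "\<bar>B\<bar> + \<bar>x\<bar> + 1"] by linarith
qed

text \<open>The two halves of the Jordan curve theorem that matter here, for a curve that bounds a
  horizontally convex region. The difference of the two bands serves as the boundary: it contains
  the frontier of the open band and also any horizontal slices that the open band omits, so that
  the graphs may touch or cross.\<close>

lemma inside_band_boundary:
  assumes "continuous_on UNIV l" "continuous_on UNIV r"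
  shows "inside (closed_band l r d - open_band l r d) = open_band l r d"
    (is "inside (?K - ?U) = ?U")
proof
  have frontier: "frontier ?U \<subseteq> ?K - ?U"
    using closure_minimal[OF open_band_subset compact_imp_closed[OF compact_closed_band[OF assms]]]
    by (auto simp: frontier_def interior_open[OF open_open_band[OF assms]])
  show "?U \<subseteq> inside (?K - ?U)"
  proof
    fix p assume p: "p \<in> ?U"
    let ?C = "connected_component_set (- (?K - ?U)) p"
    have "?C \<subseteq> ?U"
    proof (rule ccontr)
      assume "\<not> ?C \<subseteq> ?U"
      moreover have "p \<in> ?C"
        using p by (auto intro: connected_component_refl)
      ultimately have "?C \<inter> frontier ?U \<noteq> {}"
        using p by (intro connected_Int_frontier connected_connected_component) blast+
      then show False
        using frontier connected_component_subset[of "- (?K - ?U)" p] by blast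
    qed
    then have "bounded ?C"
      using compact_imp_bounded[OF compact_closed_band[OF assms]] open_band_subset
      by (meson bounded_subset)
    then show "p \<in> inside (?K - ?U)"
      using p by (simp add: inside_def)
  qed
  show "inside (?K - ?U) \<subseteq> ?U"
  proof
    fix p assume p: "p \<in> inside (?K - ?U)"
    obtain x y where xy: "p = (x, y)"
      by (cases p)
    show "p \<in> ?U"
    proof (rule ccontr)
      assume "p \<notin> ?U"
      then have "p \<notin> ?K"
        using p inside_no_overlap by blast
      \<comment> \<open>A horizontal line meets the band in an interval, so one of the two rays leaving
        \<open>p\<close> misses it.\<close>
      then obtain s :: real where s: "\<bar>s\<bar> = 1"
        and miss: "(\<lambda>t. (x + s * t, y)) ` {0..} \<inter> ?K = {}"
      proof (cases "0 \<le> y \<and> y \<le> d \<and> l y \<le> x")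
        case True
        then have "r y < x"
          using \<open>p \<notin> ?K\<close> xy by (auto simp: closed_band_def)
        then show ?thesis
          by (intro that[of 1]) (auto simp: closed_band_def)
      next
        case False
        then show ?thesis
          by (intro that[of "-1"]) (auto simp: closed_band_def)
      qed
      have "connected ((\<lambda>t. (x + s * t, y)) ` {0..})"
        by (intro connected_continuous_image continuous_intros) auto
      moreover have "p \<in> (\<lambda>t. (x + s * t, y)) ` {0..}"
        using xy by force
      ultimately have "p \<in> outside (?K - ?U)"
        using miss not_bounded_horizontal_ray[OF s]
        by (intro outside_if_unbounded_connected) auto
      then show False
        using p inside_Int_outside by blast
    qed
  qed
qed

section \<open>Integration in polar coordinates\<close>

lemma nn_integral_shells:
  fixes t :: real
  assumes "0 \<le> t"
  shows "(\<integral>\<^sup>+ y. ennreal (2 * pi * y) * indicator {0..t} y \<partial>lborel) = ennreal (pi * t\<^sup>2)"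
proof -
  have "(\<integral>\<^sup>+ y. ennreal (2 * pi * y) * indicator {0..t} y \<partial>lborel) = ennreal (pi * t\<^sup>2 - pi * 0\<^sup>2)"
    using assms
    by (intro nn_integral_FTC_Icc) (auto intro!: derivative_eq_intros)
  then show ?thesis by simp
qed

text \<open>Polar coordinates for radial functions: the disc of radius \<open>t\<close> has area \<open>\<pi> t\<^sup>2\<close>, whose derivative
  \<open>2 \<pi> t\<close> is the density of the distribution of the norm. The half-lines \<open>{..t}\<close> generate the
  Borel sets, so comparing areas of discs is enough.\<close>

lemma distr_lborel_norm:
  "distr (lborel :: (real \<times> real) measure) borel norm =
   density lborel (\<lambda>y. ennreal (2 * pi * y) * indicator {0..} y)" (is "?M = ?N")
proof (rule measure_eqI_generator_eq)
  have val: "emeasure ?M {..t} = ennreal (pi * (max t 0)\<^sup>2) \<and> emeasure ?N {..t} = ennreal (pi * (max t 0)\<^sup>2)"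
    for t :: real
  proof
    have "emeasure ?M {..t} = emeasure lborel (cball (0 :: real \<times> real) t)"
      by (subst emeasure_distr) (auto intro!: arg_cong[where f = "emeasure lborel"])
    also have "\<dots> = ennreal (pi * (max t 0)\<^sup>2)"
      by (cases "0 \<le> t") (auto simp: emeasure_cball max_def unit_ball_vol_2 power2_eq_square)
    finally show "emeasure ?M {..t} = ennreal (pi * (max t 0)\<^sup>2)" .
    have "emeasure ?N {..t} = (\<integral>\<^sup>+ y. ennreal (2 * pi * y) * indicator {0..} y * indicator {..t} y \<partial>lborel)"
      by (subst emeasure_density) auto
    also have "\<dots> = (\<integral>\<^sup>+ y. ennreal (2 * pi * y) * indicator {0..max t 0} y \<partial>lborel)"
      by (intro nn_integral_cong) (auto simp: indicator_def max_def)
    also have "\<dots> = ennreal (pi * (max t 0)\<^sup>2)"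
      by (rule nn_integral_shells) auto
    finally show "emeasure ?N {..t} = ennreal (pi * (max t 0)\<^sup>2)" .
  qed
  show "Int_stable (range (atMost :: real \<Rightarrow> real set))"
    by (auto simp: Int_stable_def)
  show "\<And>X. X \<in> range atMost \<Longrightarrow> emeasure ?M X = emeasure ?N X"
    using val by auto
  show "emeasure ?M {..real i} \<noteq> \<infinity>" for i
    using val by auto
  show "sets ?M = sigma_sets UNIV (range atMost)" "sets ?N = sigma_sets UNIV (range atMost)"
    by (simp_all add: borel_eq_atMost)
  show "(\<Union>i. {..real i}) = (UNIV :: real set)"
    by (auto intro: real_arch_simple)
qed auto

lemma nn_integral_radial:
  fixes f :: "real \<Rightarrow> ennreal"
  assumes [measurable]: "f \<in> borel_measurable borel"
  shows "(\<integral>\<^sup>+ p. f (norm (p :: real \<times> real)) \<partial>lborel) =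
    (\<integral>\<^sup>+ y. ennreal (2 * pi * y) * indicator {0..} y * f y \<partial>lborel)"
proof -
  have "(\<integral>\<^sup>+ p. f (norm (p :: real \<times> real)) \<partial>lborel) =
      (\<integral>\<^sup>+ y. f y \<partial>distr (lborel :: (real \<times> real) measure) borel norm)"
    by (subst nn_integral_distr) auto
  also have "\<dots> = (\<integral>\<^sup>+ y. ennreal (2 * pi * y) * indicator {0..} y * f y \<partial>lborel)"
    unfolding distr_lborel_norm by (subst nn_integral_density) auto
  finally show ?thesis .
qed

section \<open>Solids of revolution by cylindrical shells\<close>

lemma compact_rotate_about_x_axis:
  assumes "compact R"
  shows "compact (rotate_about_x_axis R)"
proof -
  have "rotate_about_x_axis R =
      (\<lambda>(p, \<theta>). (fst p, snd p * cos \<theta>, snd p * sin \<theta>)) ` (R \<times> {0..2 * pi})" (is "_ = ?F ` _")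
  proof (intro equalityI subsetI)
    fix q assume "q \<in> rotate_about_x_axis R"
    then obtain x y \<theta> where q: "q = (x, y * cos \<theta>, y * sin \<theta>)" "(x, y) \<in> R"
      by (auto simp: rotate_about_x_axis_def)
    obtain \<phi> where "0 \<le> \<phi>" "\<phi> < 2 * pi" "cos \<theta> = cos \<phi>" "sin \<theta> = sin \<phi>"
      using sincos_total_2pi[of "cos \<theta>" "sin \<theta>"] by (metis sin_cos_squared_add2 )
    then show "q \<in> ?F ` (R \<times> {0..2 * pi})"
      using q by (intro image_eqI[of _ _ "((x, y), \<phi>)"]) auto
  qed (force simp: rotate_about_x_axis_def)
  then show ?thesis
    using assms
    by (auto intro!: compact_continuous_image compact_Times continuous_intros
        simp: case_prod_unfold)
qed

text \<open>For a set in the upper half-plane the angle of rotation can be eliminated: the solid is the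
  preimage of the set under taking the distance to the axis.\<close>

lemma rotate_about_x_axis_upper:
  assumes "\<And>x y. (x, y) \<in> R \<Longrightarrow> 0 \<le> y"
  shows "rotate_about_x_axis R = {(x, p). (x, norm p) \<in> R}"
proof (intro equalityI subsetI)
  fix q assume "q \<in> rotate_about_x_axis R"
  then obtain x y \<theta> where q: "q = (x, y * cos \<theta>, y * sin \<theta>)" "(x, y) \<in> R"
    by (auto simp: rotate_about_x_axis_def)
  have "(y * cos \<theta>)\<^sup>2 + (y * sin \<theta>)\<^sup>2 = y\<^sup>2"
    by (metis distrib_left mult.right_neutral power_mult_distrib sin_cos_squared_add2)
  then have "norm (y * cos \<theta>, y * sin \<theta>) = y"
    using assms[OF q(2)] by (simp add: norm_Pair)
  then show "q \<in> {(x, p). (x, norm p) \<in> R}"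
    using q by simp
next
  fix q :: "real \<times> real \<times> real"
  assume "q \<in> {(x, p). (x, norm p) \<in> R}"
  then obtain x u v where q: "q = (x, u, v)" "(x, norm (u, v)) \<in> R"
    by auto
  obtain \<theta> where "u = norm (u, v) * cos \<theta>" "v = norm (u, v) * sin \<theta>"
  proof (cases "u = 0 \<and> v = 0")
    case True
    then show ?thesis
      using that by simp
  next
    case False
    define n where "n = norm (u, v)"
    have n: "n \<noteq> 0" "n\<^sup>2 = u\<^sup>2 + v\<^sup>2"
      using False by (auto simp: n_def norm_Pair add_nonneg_eq_0_iff)
    then have "(u / n)\<^sup>2 + (v / n)\<^sup>2 = 1"
      using False by (simp add: power_divide flip: add_divide_distrib)
    then obtain \<theta> where "u / n = cos \<theta>" "v / n = sin \<theta>"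
      by (rule sincos_total_2pi)
    then have "u = n * cos \<theta>" "v = n * sin \<theta>"
      using n(1) by (auto simp: field_simps)
    then show ?thesis
      unfolding n_def by (rule that)
  qed
  then show "q \<in> rotate_about_x_axis R"
    using q unfolding rotate_about_x_axis_def by blast
qed

text \<open>Slicing parallel to the axis of rotation rather than perpendicular to it: these slices are single
  intervals, while the perpendicular ones depend on how often the graphs turn back.\<close>

lemma volume_rotated_band:
  assumes l: "continuous_on UNIV l" and r: "continuous_on UNIV r" 
    and le: "\<And>y. 0 \<le> y \<Longrightarrow> y \<le> d \<Longrightarrow> l y \<le> r y"
  shows "rotate_about_x_axis (closed_band l r d) \<in> lmeasurable \<and>
         measure lebesgue (rotate_about_x_axis (closed_band l r d)) =
           integral {0..d} (\<lambda>y. 2 * pi * y * (r y - l y))"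
proof
  let ?S = "rotate_about_x_axis (closed_band l r d)"
  let ?v = "\<lambda>y. 2 * pi * y * (r y - l y)"
  have [measurable]: "l \<in> borel_measurable borel" "r \<in> borel_measurable borel"
    using l r by (auto intro: borel_measurable_continuous_onI)
  have cmp: "compact ?S"
    using compact_closed_band[OF l r] by (rule compact_rotate_about_x_axis)
  then show "?S \<in> lmeasurable"
    by (rule lmeasurable_compact)
  have S: "?S = {(x, p). (x, norm p) \<in> closed_band l r d}"
    by (rule rotate_about_x_axis_upper) (auto simp: closed_band_def)
  have slice: "emeasure lborel ((\<lambda>x. (x, p)) -` ?S) =
      ennreal (r (norm p) - l (norm p)) * indicator {..d} (norm p)" for p
  proof (cases "norm p \<le> d")
    case True
    then have "(\<lambda>x. (x, p)) -` ?S = {l (norm p)..r (norm p)}"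
      unfolding S by (auto simp: closed_band_def)
    then show ?thesis
      using True le by simp
  next
    case False
    then have "(\<lambda>x. (x, p)) -` ?S = {}"
      unfolding S by (auto simp: closed_band_def)
    then show ?thesis
      using False by simp
  qed
  have int: "?v integrable_on {0..d}"
    using l r
    by (intro integrable_continuous_real continuous_intros) (auto intro: continuous_on_subset)
  have "?S \<in> sets (lborel \<Otimes>\<^sub>M (lborel :: (real \<times> real) measure))"
    using cmp by (subst lborel_prod) (simp add: borel_compact)
  then have "emeasure (lborel \<Otimes>\<^sub>M (lborel :: (real \<times> real) measure)) ?S =
      (\<integral>\<^sup>+ p. emeasure lborel ((\<lambda>x. (x, p)) -` ?S) \<partial>lborel)"
    by (rule lborel_pair.emeasure_pair_measure_alt2)
  then have "emeasure lborel ?S = (\<integral>\<^sup>+ p. emeasure lborel ((\<lambda>x. (x, p)) -` ?S) \<partial>lborel)"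
    by (subst (asm) lborel_prod)
  also have "\<dots> = (\<integral>\<^sup>+ p. ennreal (r (norm p) - l (norm p)) * indicator {..d} (norm (p :: real \<times> real)) \<partial>lborel)"
    by (simp only: slice)
  also have "\<dots> = (\<integral>\<^sup>+ y. ennreal (2 * pi * y) * indicator {0..} y * (ennreal (r y - l y) * indicator {..d} y) \<partial>lborel)"
    by (rule nn_integral_radial) measurable
  also have "\<dots> = (\<integral>\<^sup>+ y. ennreal (?v y) * indicator {0..d} y \<partial>lborel)"
    using le by (intro nn_integral_cong) (auto simp: indicator_def ennreal_mult)
  also have "\<dots> = ennreal (integral {0..d} ?v)"
    using int le
    by (intro nn_integral_has_integral_lebesgue' integrable_integral) auto
  finally have "emeasure lborel ?S = ennreal (integral {0..d} ?v)" .
  moreover have "0 \<le> integral {0..d} ?v"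
    using int le by (intro integral_nonneg) auto
  ultimately show "measure lebesgue ?S = integral {0..d} ?v"
    using cmp by (simp add: measure_def borel_compact)
qed

section \<open>The region under the curve\<close>

lemma horizontal_closed_segment:
  fixes p q s :: real
  shows "closed_segment (p, s) (q, s) = {min p q..max p q} \<times> {s}"
proof -
  have "closed_segment (p, s) (q, s) = (\<lambda>x. (x, s)) ` closed_segment p q"
    by (force simp: closed_segment_def image_iff algebra_simps)
  then show ?thesis
    by (auto simp: closed_segment_eq_real_ivl)
qed

lemma vertical_closed_segment:
  fixes p s t :: real
  assumes "s \<le> t"
  shows "closed_segment (p, s) (p, t) = {p} \<times> {s..t}"
proof -
  have "closed_segment (p, s) (p, t) = (\<lambda>y. (p, y)) ` closed_segment s t"
    by (force simp: closed_segment_def image_iff algebra_simps)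
  then show ?thesis
    using assms by (auto simp: closed_segment_eq_real_ivl)
qed

text \<open>Freezing \<open>g\<close> outside \<open>[c, d]\<close> absorbs the vertical segment below \<open>(g c, c)\<close> into the graph and
  makes the function continuous on the whole line, as the lemmas on bands require.\<close>

definition clamped :: "(real \<Rightarrow> real) \<Rightarrow> real \<Rightarrow> real \<Rightarrow> real \<Rightarrow> real" where
  "clamped g c d y = g (max c (min d y))"

lemma continuous_on_clamped:
  assumes "continuous_on {c..d} g" "c \<le> d"
  shows "continuous_on S (clamped g c d)"
  unfolding clamped_def using assms(2)
  by (intro continuous_on_compose2[OF assms(1)] continuous_intros) auto

text \<open>For \<open>0 < y < d\<close> the ends of the slice at height \<open>y\<close> are the points of the graph and of the
  segment at \<open>g d\<close>. The slice at height \<open>0\<close> is the base, and the one at height \<open>d\<close>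
  shrinks to the common end point of the curve and that segment.\<close>

lemma boundary_curve_eq:
  fixes g :: "real \<Rightarrow> real" and c d :: real
  assumes "0 \<le> c" "c < d"
  defines "l \<equiv> \<lambda>y. min (clamped g c d y) (g d)" and "r \<equiv> \<lambda>y. max (clamped g c d y) (g d)"
  shows "boundary_curve g c d = closed_band l r d - open_band l r d"
proof -
  have low: "clamped g c d y = g c" if "y \<le> c" for y
    using that assms(1,2) by (simp add: clamped_def)
  have high: "clamped g c d y = g y" if "c \<le> y" "y \<le> d" for y
    using that by (simp add: clamped_def)
  have curve: "boundary_curve g c d =
      {min (g c) (g d)..max (g c) (g d)} \<times> {0} \<union> {g c} \<times> {0..c} \<union>
      (\<lambda>y. (g y, y)) ` {c..d} \<union> {g d} \<times> {0..d}"
    using assms(1,2)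
    by (simp add: boundary_curve_def curve_x_of_y_def horizontal_closed_segment vertical_closed_segment)
  have band: "(x, y) \<in> closed_band l r d - open_band l r d \<longleftrightarrow>
      0 \<le> y \<and> y \<le> d \<and> l y \<le> x \<and> x \<le> r y \<and>
      (y = 0 \<or> y = d \<or> x = clamped g c d y \<or> x = g d)" for x y
    by (auto simp: closed_band_def open_band_def l_def r_def min_def max_def)
  have bd: "(x, y) \<in> boundary_curve g c d \<longleftrightarrow>
      0 \<le> y \<and> y \<le> d \<and> l y \<le> x \<and> x \<le> r y \<and>
      (y = 0 \<or> y = d \<or> x = clamped g c d y \<or> x = g d)" for x y
  proof
    assume "(x, y) \<in> boundary_curve g c d"
    then show "0 \<le> y \<and> y \<le> d \<and> l y \<le> x \<and> x \<le> r y \<and>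
      (y = 0 \<or> y = d \<or> x = clamped g c d y \<or> x = g d)"
      using assms(1,2) low[of y] high[of y] by (auto simp: curve l_def r_def)
  next
    assume *: "0 \<le> y \<and> y \<le> d \<and> l y \<le> x \<and> x \<le> r y \<and>
      (y = 0 \<or> y = d \<or> x = clamped g c d y \<or> x = g d)"
    then consider "y = 0" | "y = d" | "x = clamped g c d y" "y \<le> c" | "x = clamped g c d y" "c \<le> y" | "x = g d"
      by linarith
    then show "(x, y) \<in> boundary_curve g c d"
      using * assms(1,2) low[of y] high[of y]
      by cases (auto simp: curve l_def r_def)
  qed
  then show ?thesis
    using band by (auto simp del: Diff_iff)
qed

lemma bounded_region_eq:
  assumes "0 \<le> c" "c < d" and cont: "continuous_on {c..d} g"
  shows "bounded_region g c d =
    closed_band (\<lambda>y. min (clamped g c d y) (g d)) (\<lambda>y. max (clamped g c d y) (g d)) d"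
    (is "_ = closed_band ?l ?r d")
proof -
  have cont_h: "continuous_on UNIV (clamped g c d)"
    using assms by (intro continuous_on_clamped) auto
  have eq: "boundary_curve g c d = closed_band ?l ?r d - open_band ?l ?r d"
    using assms(1,2) by (rule boundary_curve_eq)
  have "inside (boundary_curve g c d) = open_band ?l ?r d"
    unfolding eq by (intro inside_band_boundary continuous_intros cont_h)
  then show ?thesis
    using open_band_subset[of ?l ?r d] by (auto simp: bounded_region_def eq)
qed

text \<open>A continuous function that avoids the value \<open>k\<close> stays on one side of it. This makes the
  sign in the volume formula independent of the height.\<close>

lemma sgn_diff_eq_if_avoids:
  fixes g :: "real \<Rightarrow> real"
  assumes "continuous_on {c..d} g" "y \<in> {c..d}" "\<And>z. z \<in> {c..y} \<Longrightarrow> g z \<noteq> k"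
  shows "sgn (k - g y) = sgn (k - g c)"
proof -
  have cont: "continuous_on {c..y} g"
    using assms(1,2) by (auto intro: continuous_on_subset)
  show ?thesis
    using IVT'[of g c k y] IVT2'[of g y k c] assms(2,3) cont by (force simp: sgn_if)
qed

lemma integral_clamped:
  assumes "0 \<le> c" "c \<le> d" "continuous_on {c..d} g"
  shows "integral {0..d} (\<lambda>y. y * clamped g c d y) = c\<^sup>2 / 2 * g c + integral {c..d} (\<lambda>y. y * g y)"
proof -
  have "integral {0..d} (\<lambda>y. y * clamped g c d y) =
      integral {0..c} (\<lambda>y. y * clamped g c d y) + integral {c..d} (\<lambda>y. y * clamped g c d y)"
    using assms
    by (intro Henstock_Kurzweil_Integration.integral_combine[symmetric] integrable_continuous_real
        continuous_intros continuous_on_clamped) auto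
  also have "integral {0..c} (\<lambda>y. y * clamped g c d y) = integral {0..c} (\<lambda>y. y * g c)"
    using assms by (intro integral_cong) (auto simp: clamped_def)
  also have "integral {0..c} (\<lambda>y. y * g c) = c\<^sup>2 / 2 * g c"
    using assms by simp
  also have "integral {c..d} (\<lambda>y. y * clamped g c d y) = integral {c..d} (\<lambda>y. y * g y)"
    by (intro integral_cong) (auto simp: clamped_def)
  finally show ?thesis .
qed

theorem theorem3:
  fixes g :: "real \<Rightarrow> real" and a b c d :: real
  assumes "0 \<le> c" and "c < d"
    and "continuous_on {c..d} g"
    and "piecewise_strictly_monotone g c d"
    and "g differentiable_on {c..d}"
    and "a = min (g c) (g d)" and "b = max (g c) (g d)" and "a < b"
    and "\<exists>!p. p \<in> curve_x_of_y g c d \<and> fst p = a"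
    and "\<exists>!p. p \<in> curve_x_of_y g c d \<and> fst p = b"
  shows "rotate_about_x_axis (bounded_region g c d) \<in> lmeasurable \<and>
         measure lebesgue (rotate_about_x_axis (bounded_region g c d)) =
           sgn (g d - g c) *
             (pi * (d\<^sup>2 * g d - c\<^sup>2 * g c) - 2 * pi * integral {c..d} (\<lambda>y. y * g y))"
proof -
  let ?h = "clamped g c d"
  let ?l = "\<lambda>y. min (?h y) (g d)" and ?r = "\<lambda>y. max (?h y) (g d)"
  have "g d = a \<or> g d = b"
    using assms(6,7) by linarith
  then have "\<exists>!p. p \<in> curve_x_of_y g c d \<and> fst p = g d"
    using assms(9,10) by auto
  then have unique: "y = d" if "y \<in> {c..d}" "g y = g d" for y
    using that \<open>c < d\<close> unfolding curve_x_of_y_def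
    by (metis (no_types, lifting) atLeastAtMost_iff fst_conv image_eqI less_eq_real_def prod.inject)
  have cont: "continuous_on S ?h" for S
    using assms(2,3) by (intro continuous_on_clamped) auto
  have sign: "sgn (g d - g c) * (g d - ?h y) = ?r y - ?l y" if y: "y \<in> {0..d}" for y
  proof (cases "y = d")
    case True
    then show ?thesis
      using \<open>c < d\<close> by (simp add: clamped_def)
  next
    case False
    then have "sgn (g d - ?h y) = sgn (g d - g c)"
      using y assms(2,3) unique unfolding clamped_def
      by (intro sgn_diff_eq_if_avoids) force+
    then show ?thesis
      by (auto simp: sgn_if split: if_splits)
  qed
  have "integral {0..d} (\<lambda>y. 2 * pi * y * (?r y - ?l y)) =
      integral {0..d} (\<lambda>y. 2 * pi * sgn (g d - g c) * (y * g d - y * ?h y))"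
    by (intro integral_cong) (simp only: sign[symmetric], simp add: algebra_simps)
  also have "\<dots> = 2 * pi * sgn (g d - g c) * (integral {0..d} (\<lambda>y. y * g d) - integral {0..d} (\<lambda>y. y * ?h y))"
    by (subst integral_mult_right, subst integral_diff)
      (auto intro!: integrable_continuous_real continuous_intros cont)
  also have "integral {0..d} (\<lambda>y. y * g d) = d\<^sup>2 / 2 * g d"
    using assms(1,2) by simp
  also have "integral {0..d} (\<lambda>y. y * ?h y) = c\<^sup>2 / 2 * g c + integral {c..d} (\<lambda>y. y * g y)"
    using assms(1,2,3) by (intro integral_clamped) auto
  finally have "integral {0..d} (\<lambda>y. 2 * pi * y * (?r y - ?l y)) =
      sgn (g d - g c) * (pi * (d\<^sup>2 * g d - c\<^sup>2 * g c) - 2 * pi * integral {c..d} (\<lambda>y. y * g y))"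
    by (simp add: algebra_simps)
  moreover have "rotate_about_x_axis (closed_band ?l ?r d) \<in> lmeasurable \<and>
      measure lebesgue (rotate_about_x_axis (closed_band ?l ?r d)) =
        integral {0..d} (\<lambda>y. 2 * pi * y * (?r y - ?l y))"
    by (rule volume_rotated_band) (auto intro!: continuous_intros cont)
  ultimately show ?thesis
    using bounded_region_eq[OF assms(1-3)] by simp
qed

end
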